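(* Let $q=2^s$ with $s\ge1$ and $\mathbb{A}=\mathbb{F}_q[X]$. Let $f\in\mathbb{A}$ with $\deg f\ge 1$ have prime factorization $f=aP_1^{e_1}\cdots P_t^{e_t}$, where $a\in\mathbb{F}_q^*$, the $P_j$ are distinct monic irreducible polynomials and $e_j\ge 1$. Then $$G(f)\equiv\begin{cases} f/P_1+1 \pmod f & \text{if } q=2,\ \deg P_1=1,\ 2\le e_1\le 3, \text{ and } e_j=1 \text{ for all } j\ne 1 \text{ (if any)},\\ 1\pmod f & \text{otherwise}.\end{cases}$$
   Context: For $f\in\mathbb{A}$ with $\deg f\ge 1$, the Gauss factorial is $G(f)=\prod g$, the product over all non-zero $g\in\mathbb{A}$ with $0\le \deg g<\deg f$ and $\gcd(g,f)=1$.
   Formalization: The numbering of the primes is arbitrary, so the condition on P_1 is read as holding for some P_k in the role of P_1 (after renumbering), with value f/P_k+1; for a fixed P_1 the "otherwise" case fails, e.g. q=2, P_1=X+1, P_2=X, f=P_1P_2^2. *)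

theory Defs
  imports "HOL-Number_Theory.Number_Theory" "HOL-Computational_Algebra.Polynomial" "HOL-Library.Cardinality"
begin

(* The clause g \<noteq> 0 is needed because degree 0 = 0 in the library. *)
definition gauss_factorial :: "'a::{finite,field} poly \<Rightarrow> 'a poly" where
  "gauss_factorial f = \<Prod>{g. g \<noteq> 0 \<and> degree g < degree f \<and> coprime g f}"

(* The numbering of the prime factors is arbitrary, so the distinguished factor,
   written P_1 in the informal statement, is allowed to have any index k. *)
definition exceptional_index ::
    "nat \<Rightarrow> (nat \<Rightarrow> 'a::{finite,field} poly) \<Rightarrow> (nat \<Rightarrow> nat) \<Rightarrow> nat \<Rightarrow> bool" where
  "exceptional_index t P e k \<longleftrightarrow>
     k \<in> {1..t} \<and> CARD('a) = 2 \<and> degree (P k) = 1 \<and> 2 \<le> e k \<and> e k \<le> 3 \<and>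
     (\<forall>j\<in>{1..t}. j \<noteq> k \<longrightarrow> e j = 1)"

end

theory Submission
  imports Defs "HOL-Computational_Algebra.Polynomial_Factorial"
begin

text \<open>
  In the unit group of \<open>\<bbbF>\<^sub>q[X]/(f)\<close> every element cancels against its inverse, except for the \<open>u\<close> with
  \<open>u\<^sup>2 = 1\<close>. In characteristic 2 this equation reads \<open>(u - 1)\<^sup>2 = 0\<close>, so these \<open>u\<close> are the
  \<open>1 + r m\<close> with \<open>r = \<Prod> P\<^sub>j ^ \<lceil>e\<^sub>j / 2\<rceil>\<close> and \<open>deg m < n = deg f - deg r\<close>. Since \<open>f\<close> divides \<open>r\<^sup>2\<close>,
  their product is \<open>1 + r \<Sum> m\<close>, and the sum of all polynomials of degree less than \<open>n\<close> vanishes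
  unless \<open>q = 2\<close> and \<open>n = \<Sum> \<lfloor>e\<^sub>j / 2\<rfloor> deg P\<^sub>j = 1\<close>; the latter is the exceptional case, where \<open>r = f / P\<^sub>1\<close>.
\<close>

section \<open>Inverses and products of residues\<close>

text \<open>The extended Euclidean algorithm, run as an induction on
  \<open>euclidean_size b\<close>; it supplies inverses modulo \<open>f\<close>.\<close>

lemma coprime_imp_bezout:
  fixes a b :: "'a::unique_euclidean_ring"
  assumes "coprime a b"
  obtains u v where "u * a + v * b = 1"
proof -
  have "\<exists>u v. u * a + v * b = 1"
    using assms
  proof (induction "euclidean_size b" arbitrary: a b rule: less_induct)
    case less
    show ?case
    proof (cases "b = 0")
      case True
      with less.prems have "a dvd 1"
        by simp
      then obtain c where "1 = a * c" ..
      then show ?thesis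
        by (intro exI[of _ c] exI[of _ 0]) (simp add: ac_simps)
    next
      case False
      have "coprime b (a mod b)"
        using less.prems False by (simp add: coprime_commute)
      moreover have "euclidean_size (a mod b) < euclidean_size b"
        using False by (rule mod_size_less)
      ultimately obtain u v where "u * b + v * (a mod b) = 1"
        using less.hyps by blast
      \<comment> \<open>Back substitution of \<open>a mod b = a - (a div b) * b\<close>.\<close>
      then have "v * a + (u - v * (a div b)) * b = 1"
        by (simp add: minus_div_mult_eq_mod [symmetric] algebra_simps)
      then show ?thesis
        by blast
    qed
  qed
  with that show thesis
    by blast
qed

text \<open>Each orbit \<open>{x, i x}\<close> with two elements contributes a factor congruent to
  1, so only the fixed points survive. The induction removes one such orbit at a time.\<close>

lemma cong_prod_involution:
  fixes f :: "'a::unique_euclidean_ring"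
  assumes "finite A"
    and "\<And>x. x \<in> A \<Longrightarrow> i x \<in> A"
    and "\<And>x. x \<in> A \<Longrightarrow> i (i x) = x"
    and "\<And>x. x \<in> A \<Longrightarrow> [x * i x = 1] (mod f)"
  shows "[\<Prod>A = \<Prod>{x \<in> A. i x = x}] (mod f)"
  using assms
proof (induction A rule: finite_psubset_induct)
  case (psubset A)
  show ?case
  proof (cases "\<forall>x\<in>A. i x = x")
    case True
    then have "{x \<in> A. i x = x} = A"
      by blast
    then show ?thesis
      by simp
  next
    case False
    then obtain x where x: "x \<in> A" "i x \<noteq> x"
      by blast
    define B where "B = A - {x, i x}"
    have ix: "i x \<in> A" "i (i x) = x"
      using psubset.prems x by auto
    have "[\<Prod>B = \<Prod>{y \<in> B. i y = y}] (mod f)"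
    proof (rule psubset.IH)
      show "B \<subset> A"
        using x by (auto simp: B_def)
      \<comment> \<open>If \<open>i y\<close> were \<open>x\<close> or \<open>i x\<close>, applying
        \<open>i\<close> again would put \<open>y\<close> into the removed orbit.\<close>
      show "i y \<in> B" if "y \<in> B" for y
        using that psubset.prems(1,2) ix by (metis B_def DiffD1 DiffD2 DiffI insert_iff singletonD)
    qed (use psubset.prems in \<open>auto simp: B_def\<close>)
    moreover have "{y \<in> B. i y = y} = {y \<in> A. i y = y}"
      using x ix by (auto simp: B_def)
    moreover have "\<Prod>A = (x * i x) * \<Prod>B"
    proof -
      have "A = insert x (insert (i x) B)"
        using x ix by (auto simp: B_def)
      moreover have "finite B" "x \<notin> insert (i x) B" "i x \<notin> B"
        using psubset.hyps x by (auto simp: B_def)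
      ultimately show ?thesis
        by (simp add: mult.assoc)
    qed
    ultimately show ?thesis
      using cong_mult[OF psubset.prems(3)[OF x(1)], of "\<Prod>B" "\<Prod>{y \<in> B. i y = y}"] by simp
  qed
qed

text \<open>Every term of the expanded product with two factors \<open>r\<close> vanishes modulo
  \<open>r ^ 2\<close>, so multiplying the \<open>1 + r * g x\<close> amounts to adding the
  \<open>g x\<close>.\<close>

lemma cong_prod_one_plus_mult:
  fixes r :: "'a::unique_euclidean_ring"
  shows "[(\<Prod>x\<in>A. 1 + r * g x) = 1 + r * (\<Sum>x\<in>A. g x)] (mod r ^ 2)"
proof (induction A rule: infinite_finite_induct)
  case (insert x A)
  have "[(1 + r * g x) * (\<Prod>x\<in>A. 1 + r * g x) = (1 + r * g x) * (1 + r * (\<Sum>x\<in>A. g x))] (mod r ^ 2)"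
    using insert.IH by (intro cong_mult cong_refl)
  also have "(1 + r * g x) * (1 + r * (\<Sum>x\<in>A. g x)) =
      1 + r * (\<Sum>x\<in>insert x A. g x) + r ^ 2 * (g x * (\<Sum>x\<in>A. g x))"
    using insert.hyps by (simp add: algebra_simps power2_eq_square)
  also have "[\<dots> = 1 + r * (\<Sum>x\<in>insert x A. g x)] (mod r ^ 2)"
    by (simp add: cong_iff_dvd_diff)
  finally show ?case
    using insert.hyps by simp
qed simp_all

section \<open>Sums over all polynomials of bounded degree\<close>

lemma poly_coeff_bounded_0: "{m :: 'a::zero poly. \<forall>i\<ge>0. coeff m i = 0} = {0}"
  by (auto simp: poly_eq_iff)

text \<open>Splitting off the constant coefficient gives a recursion in \<open>n\<close>. The bound
  is put on coefficients because \<open>degree 0 = 0\<close>: a condition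
  \<open>degree m < n\<close> would lose the zero polynomial at \<open>n = 0\<close>, where the
  recursion starts.\<close>

lemma poly_coeff_bounded_Suc:
  "{m :: 'a::zero poly. \<forall>i\<ge>Suc n. coeff m i = 0} =
     (\<lambda>(c, m). pCons c m) ` (UNIV \<times> {m. \<forall>i\<ge>n. coeff m i = 0})" (is "?L = ?R")
proof (intro equalityI subsetI)
  fix m assume "m \<in> ?L"
  then show "m \<in> ?R"
    by (cases m) (force simp: coeff_pCons split: nat.splits)
qed (auto simp: coeff_pCons split: nat.splits)

lemma inj_on_pCons: "inj_on (\<lambda>(c, m). pCons c m) A"
  by (auto intro!: inj_onI)

lemma finite_poly_coeff_bounded:
  "finite {m :: 'a::{finite,zero} poly. \<forall>i\<ge>n. coeff m i = 0}"
  by (induction n) (simp_all only: poly_coeff_bounded_0 poly_coeff_bounded_Suc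
      finite_imageI finite_SigmaI finite finite.intros)

lemma finite_degree_less:
  "finite {g :: 'a::{finite,zero} poly. degree g < n}"
  by (rule finite_subset[OF _ finite_poly_coeff_bounded[of n]]) (auto intro: coeff_eq_0)

text \<open>Among the \<open>pCons c m\<close>, each \<open>c\<close> occurs once for every
  \<open>m\<close> in \<open>D n\<close>, and each \<open>m\<close> once for every
  \<open>c\<close>.\<close>

lemma sum_poly_coeff_bounded_Suc:
  fixes n :: nat
  defines "D \<equiv> \<lambda>n. {m :: 'a::{finite,comm_ring_1} poly. \<forall>i\<ge>n. coeff m i = 0}"
  shows "\<Sum>(D (Suc n)) = pCons (of_nat (card (D n)) * (\<Sum>c\<in>UNIV. c)) (of_nat CARD('a) * \<Sum>(D n))"
proof -
  have pCons_eq: "pCons c m = [:c:] + pCons 0 m" for c and m :: "'a poly"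
    by simp
  have const: "(\<Sum>c\<in>A. [:g c:]) = [:\<Sum>c\<in>A. g c:]" for A :: "'a set" and g :: "'a \<Rightarrow> 'a"
    by (induction A rule: infinite_finite_induct) auto
  have shift: "(\<Sum>m\<in>A. pCons 0 m) = pCons 0 (\<Sum>A)" for A :: "'a poly set"
    by (induction A rule: infinite_finite_induct) auto
  have "\<Sum>(D (Suc n)) = (\<Sum>c\<in>UNIV. \<Sum>m\<in>D n. pCons c m)"
    unfolding D_def poly_coeff_bounded_Suc
    by (subst sum.reindex[OF inj_on_pCons]) (simp add: sum.cartesian_product case_prod_unfold)
  also have "\<dots> = (\<Sum>c\<in>UNIV. of_nat (card (D n)) * [:c:] + pCons 0 (\<Sum>(D n)))"
    by (subst pCons_eq) (simp only: sum.distrib shift sum_constant)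
  also have "\<dots> = of_nat (card (D n)) * [:\<Sum>c\<in>UNIV. c:] + of_nat CARD('a) * pCons 0 (\<Sum>(D n))"
    by (simp only: sum.distrib sum_constant const sum_distrib_left [symmetric])
  also have "\<dots> = pCons (of_nat (card (D n)) * (\<Sum>c\<in>UNIV. c)) (of_nat CARD('a) * \<Sum>(D n))"
    by (simp add: of_nat_poly)
  finally show ?thesis .
qed

text \<open>Translation by 1 permutes the ring, yet adds \<open>CARD('a)\<close> ones to the sum of
  all elements.\<close>

lemma of_nat_CARD_eq_0: "of_nat CARD('a) = (0 :: 'a::{finite,ring_1})"
proof -
  have "(\<Sum>x\<in>UNIV. x) = (\<Sum>x\<in>UNIV. x + 1 :: 'a)"
    by (rule sum.reindex_bij_witness[of _ "\<lambda>x. x + 1" "\<lambda>x. x - 1"]) auto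
  then show ?thesis
    by (simp add: sum.distrib)
qed

text \<open>Multiplication by some \<open>c\<close> other than 0 and 1 permutes the field, so the
  sum is fixed by the factor \<open>c\<close> and must vanish. Only the field with two elements has
  no such \<open>c\<close>.\<close>

lemma sum_UNIV_finite_field:
  "(\<Sum>c\<in>UNIV. c) = (if CARD('a) = 2 then 1 else 0 :: 'a::{finite,field})"
proof (cases "CARD('a) = 2")
  case True
  have "{0, 1 :: 'a} = UNIV"
    by (rule card_subset_eq) (use True in auto)
  then have "(\<Sum>c\<in>UNIV. c) = (\<Sum>c\<in>{0, 1 :: 'a}. c)"
    by simp
  with True show ?thesis
    by simp
next
  case False
  have "UNIV \<noteq> {0, 1 :: 'a}"
    using False by (metis card_2_iff zero_neq_one)
  then obtain c :: 'a where c: "c \<noteq> 0" "c \<noteq> 1"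
    by blast
  have "(\<Sum>x\<in>UNIV. x) = (\<Sum>x\<in>UNIV. c * x)"
    by (rule sum.reindex_bij_witness[of _ "\<lambda>x. c * x" "\<lambda>x. x / c"]) (use c in auto)
  then have "(1 - c) * (\<Sum>x\<in>UNIV. x) = 0"
    by (simp add: left_diff_distrib flip: sum_distrib_left)
  with c False show ?thesis
    by simp
qed

text \<open>Since \<open>CARD('a)\<close> is 0 in the field, the recursion leaves only a constant
  coefficient. Its factor \<open>card (D n)\<close> is again a multiple of \<open>CARD('a)\<close>
  unless \<open>n = 0\<close>.\<close>

lemma sum_poly_coeff_bounded:
  "\<Sum>{m :: 'a::{finite,field} poly. \<forall>i\<ge>n. coeff m i = 0} = (if n = 1 \<and> CARD('a) = 2 then 1 else 0)"
proof -
  define D where "D = (\<lambda>n. {m :: 'a poly. \<forall>i\<ge>n. coeff m i = 0})"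
  have D0: "D 0 = {0}"
    using poly_coeff_bounded_0 by (simp add: D_def)
  have q: "of_nat CARD('a) = (0 :: 'a poly)"
    by (simp add: of_nat_poly of_nat_CARD_eq_0)
  have Suc: "\<Sum>(D (Suc n)) = [:of_nat (card (D n)) * (\<Sum>c\<in>UNIV. c):]" for n
    using sum_poly_coeff_bounded_Suc[where 'a = 'a, of n] q by (simp add: D_def)
  have "\<Sum>(D n) = (if n = 1 \<and> CARD('a) = 2 then 1 else 0)"
  proof (cases n)
    case 0
    then show ?thesis
      by (simp add: D0)
  next
    case n: (Suc k)
    show ?thesis
    proof (cases k)
      case 0
      then show ?thesis
        using n by (simp add: Suc D0 sum_UNIV_finite_field one_pCons)
    next
      case (Suc l)
      have "card (D k) = CARD('a) * card (D l)"
        unfolding D_def Suc poly_coeff_bounded_Suc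
        by (simp add: card_image[OF inj_on_pCons] card_cartesian_product)
      then have "of_nat (card (D k)) = (0 :: 'a)"
        by (simp add: of_nat_CARD_eq_0)
      then show ?thesis
        using n Suc by (simp add: \<open>\<And>n. \<Sum>(D (Suc n)) = _\<close>)
    qed
  qed
  then show ?thesis
    by (simp add: D_def)
qed

section \<open>Divisors of squares\<close>

text \<open>The exponent \<open>e j - e j div 2\<close> is \<open>e j / 2\<close> rounded up, the
  least multiplicity of \<open>P j\<close> in \<open>h\<close> that yields \<open>e j\<close> in
  \<open>h ^ 2\<close>. Distinct monic irreducibles are not associated, so these powers divide
  \<open>h\<close> jointly.\<close>

lemma prod_monic_irreducible_powers_dvd_square:
  fixes P :: "'i \<Rightarrow> 'a::field poly"
  assumes "finite J" and "inj_on P J"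
    and "\<And>j. j \<in> J \<Longrightarrow> irreducible (P j)"
    and "\<And>j. j \<in> J \<Longrightarrow> lead_coeff (P j) = 1"
    and "(\<Prod>j\<in>J. P j ^ e j) dvd h ^ 2"
  shows "(\<Prod>j\<in>J. P j ^ (e j - e j div 2)) dvd h"
  using assms
proof (induction J rule: finite_induct)
  case (insert k J)
  have prime: "prime_elem (P j)" if "j \<in> insert k J" for j
    using that insert.prems by (intro field_poly_irreducible_imp_prime) auto
  define r where "r = (\<Prod>j\<in>J. P j ^ (e j - e j div 2))"
  have "r dvd h"
    unfolding r_def using insert.hyps insert.prems by (intro insert.IH) (auto elim: dvd_mult_right)
  then obtain m where m: "h = r * m" ..
  have "P k ^ e k dvd h * h"
    using insert.hyps insert.prems(4) by (auto simp: power2_eq_square elim: dvd_mult_left)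
  \<comment> \<open>The \<open>e k\<close> factors \<open>P k\<close> are shared out between the two
    copies of \<open>h\<close>; the larger share is at least half of them, rounded up.\<close>
  then obtain a b where ab: "a + b = e k" "P k ^ a dvd h" "P k ^ b dvd h"
    using prime_elem_power_dvd_prod prime by blast
  have "P k ^ (e k - e k div 2) dvd h"
  proof (cases "a \<le> b")
    case True
    then have "e k - e k div 2 \<le> b"
      using ab(1) by linarith
    then show ?thesis
      using ab(3) power_le_dvd by blast
  next
    case False
    then have "e k - e k div 2 \<le> a"
      using ab(1) by linarith
    then show ?thesis
      using ab(2) power_le_dvd by blast
  qed
  \<comment> \<open>Otherwise \<open>P k\<close> divides some \<open>P j\<close> with
    \<open>j \<in> J\<close>. Both are irreducible, so they differ by a constant, which is 1 because
    both are monic; this contradicts injectivity of \<open>P\<close>.\<close>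
  moreover have "\<not> P k dvd r"
  proof
    assume "P k dvd r"
    have dvd_factor: "\<exists>j\<in>A. P k dvd P j" if "finite A" "P k dvd (\<Prod>j\<in>A. P j ^ c j)" for A c
      using that
    proof (induction A rule: finite_induct)
      case empty
      then show ?case
        using prime[of k] by (auto dest: prime_elem_not_unit)
    next
      case (insert j A)
      then have "P k dvd P j ^ c j * (\<Prod>j\<in>A. P j ^ c j)"
        by simp
      then consider "P k dvd P j ^ c j" | "P k dvd (\<Prod>j\<in>A. P j ^ c j)"
        using prime[of k] prime_elem_dvd_multD by blast
      then show ?case
        using insert.IH prime_elem_dvd_power[OF prime[of k]] by cases blast+
    qed
    obtain j where j: "j \<in> J" "P k dvd P j"
      using dvd_factor[OF insert.hyps(1) \<open>P k dvd r\<close>[unfolded r_def]] by blast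
    then have "irreducible (P j)"
      using insert.prems(2) by blast
    moreover have "\<not> P k dvd 1"
      using prime[of k] prime_elem_not_unit by blast
    moreover obtain c where c: "P j = P k * c"
      using j(2) ..
    ultimately have "c dvd 1"
      using irreducibleD by blast
    then obtain d where "c = [:d:]"
      by (elim is_unit_polyE)
    then have "P k = P j"
      using c j(1) insert.prems(3)[of j] insert.prems(3)[of k] by (auto split: if_splits)
    then show False
      using j insert.hyps insert.prems(1) by auto
  qed
  ultimately have "P k ^ (e k - e k div 2) dvd m"
    using prime_power_dvd_multD[OF prime[of k]] m
    by (metis gr0I insertI1 one_dvd power_0)
  then show ?case
    using insert.hyps m by (auto simp: r_def[symmetric] mult.commute intro: mult_dvd_mono)
qed simp

section \<open>The Gauss factorial and the square roots of 1\<close>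

text \<open>Wilson's argument: inversion is an involution on the reduced units modulo
  \<open>f\<close>, and its fixed points are the \<open>u\<close> with \<open>u ^ 2\<close>
  congruent to 1.\<close>

lemma gauss_factorial_cong_prod_square_roots_of_1:
  fixes f :: "'a::{finite,field} poly"
  assumes "degree f \<ge> 1"
  shows "[gauss_factorial f = \<Prod>{u. degree u < degree f \<and> f dvd u ^ 2 - 1}] (mod f)"
proof -
  define U where "U = {g. g \<noteq> 0 \<and> degree g < degree f \<and> coprime g f}"
  define i where "i = (\<lambda>g. THE h. h \<in> U \<and> [g * h = 1] (mod f))"
  have "f \<noteq> 0"
    using assms by auto
  then have f: "f \<noteq> 0" "\<not> f dvd 1"
    using assms by (simp_all add: is_unit_iff_degree)
  have coprimeI: "coprime g f" if "[g * h = 1] (mod f)" for g h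
  proof (rule coprimeI)
    fix c assume "c dvd g" "c dvd f"
    with that show "c dvd 1"
      by (metis (no_types, opaque_lifting) cong_dvd_modulus cong_dvd_iff dvd_mult2)
  qed
  \<comment> \<open>Being invertible excludes \<open>g = 0\<close>, as \<open>f\<close> is no unit,
    and forces coprimality to \<open>f\<close>.\<close>
  have UI: "g \<in> U" if "[g * h = 1] (mod f)" "degree g < degree f" for g h
  proof -
    have "g \<noteq> 0"
      using that f by (auto simp: cong_iff_dvd_diff)
    then show ?thesis
      using that coprimeI by (auto simp: U_def)
  qed
  have ex1: "\<exists>!h. h \<in> U \<and> [g * h = 1] (mod f)" if "g \<in> U" for g
  proof (rule ex_ex1I)
    have "coprime g f"
      using that by (simp add: U_def)
    then obtain u v where uv: "u * g + v * f = 1"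
      by (rule coprime_imp_bezout)
    have "g * u - 1 = f * (- v)"
      using uv by (simp add: algebra_simps eq_diff_eq)
    then have "[g * u = 1] (mod f)"
      by (simp add: cong_iff_dvd_diff)
    then have inv: "[g * (u mod f) = 1] (mod f)"
      by (simp add: cong_def mod_mult_right_eq)
    have "degree (u mod f) < degree f"
      using degree_mod_less[of f u] f assms by auto
    then have "u mod f \<in> U"
      using inv by (intro UI[of _ g]) (simp_all add: mult.commute)
    with inv show "\<exists>h. h \<in> U \<and> [g * h = 1] (mod f)"
      by blast
  next
    \<comment> \<open>Two inverses satisfy \<open>h = h * (g * k) = (h * g) * k = k\<close> modulo
      \<open>f\<close>, and both are reduced, hence equal.\<close>
    fix h k assume h: "h \<in> U \<and> [g * h = 1] (mod f)" and k: "k \<in> U \<and> [g * k = 1] (mod f)"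
    have "[h * 1 = h * (g * k)] (mod f)"
      using k by (intro cong_mult cong_refl) (simp add: cong_sym)
    also have "h * (g * k) = (g * h) * k"
      by simp
    also have "[(g * h) * k = 1 * k] (mod f)"
      using h by (intro cong_mult cong_refl) simp
    finally have "h mod f = k mod f"
      by (simp add: cong_def)
    then show "h = k"
      using h k by (simp add: U_def mod_poly_less)
  qed
  have i: "i g \<in> U" "[g * i g = 1] (mod f)" if "g \<in> U" for g
    using theI'[OF ex1[OF that]] by (auto simp: i_def)
  have i_eq: "i g = h" if "g \<in> U" "h \<in> U" "[g * h = 1] (mod f)" for g h
    using ex1[OF that(1)] i[OF that(1)] that by blast
  have "finite U"
    by (rule finite_subset[OF _ finite_degree_less[of "degree f"]]) (auto simp: U_def)
  then have "[\<Prod>U = \<Prod>{g \<in> U. i g = g}] (mod f)"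
  proof (rule cong_prod_involution)
    show "i (i g) = g" if "g \<in> U" for g
      using i[OF that] that by (intro i_eq) (simp_all add: mult.commute)
  qed (use i in auto)
  also have "{g \<in> U. i g = g} = {u. degree u < degree f \<and> f dvd u ^ 2 - 1}"
  proof (intro equalityI subsetI)
    fix g assume "g \<in> {g \<in> U. i g = g}"
    then show "g \<in> {u. degree u < degree f \<and> f dvd u ^ 2 - 1}"
      using i[of g] by (auto simp: U_def cong_iff_dvd_diff power2_eq_square)
  next
    fix g assume "g \<in> {u. degree u < degree f \<and> f dvd u ^ 2 - 1}"
    then have g: "degree g < degree f" "[g * g = 1] (mod f)"
      by (auto simp: cong_iff_dvd_diff power2_eq_square)
    with UI have "g \<in> U"
      by blast
    with g i_eq show "g \<in> {g \<in> U. i g = g}"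
      by blast
  qed
  finally show ?thesis
    by (simp add: gauss_factorial_def U_def)
qed

text \<open>By \<open>root\<close>, the \<open>h\<close> with \<open>f dvd h ^ 2\<close> form the
  ideal generated by \<open>r\<close>. Taking \<open>h = f\<close> gives \<open>r dvd f\<close>, and
  \<open>h = r\<close> gives \<open>f dvd r ^ 2\<close>.\<close>

lemma gauss_factorial_cong_char_2:
  fixes f r :: "'a::{finite,field} poly"
  assumes "degree f \<ge> 1" and "(2 :: 'a) = 0"
    and root: "\<And>h. f dvd h ^ 2 \<longleftrightarrow> r dvd h"
  shows "[gauss_factorial f = (if degree f = Suc (degree r) \<and> CARD('a) = 2 then 1 + r else 1)] (mod f)"
proof -
  define D where "D = {m :: 'a poly. \<forall>i \<ge> degree f - degree r. coeff m i = 0}"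
  have "f \<noteq> 0"
    using assms(1) by auto
  have "r dvd f"
    using root[of f] by (simp add: power2_eq_square)
  then have r: "r \<noteq> 0" "degree r \<le> degree f"
    using \<open>f \<noteq> 0\<close> by (auto intro: dvd_imp_degree_le)
  have two: "(2 :: 'a poly) = 0"
    using assms(2) by (simp add: poly_eq_iff numeral_poly coeff_pCons split: nat.splits)
  have square: "u ^ 2 - 1 = (u - 1) ^ 2" for u :: "'a poly"
  proof -
    have "(u - 1) ^ 2 = u ^ 2 - 1 - 2 * (u - 1)"
      by (simp add: power2_eq_square algebra_simps)
    then show ?thesis
      using two by simp
  qed
  have roots: "{u. degree u < degree f \<and> f dvd u ^ 2 - 1} = (\<lambda>m. 1 + r * m) ` D"
  proof (intro equalityI subsetI)
    fix u assume "u \<in> {u. degree u < degree f \<and> f dvd u ^ 2 - 1}"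
    then have u: "degree u < degree f" "r dvd u - 1"
      by (auto simp: square root)
    then obtain m where m: "u - 1 = r * m"
      by (auto elim: dvdE)
    have "degree (r * m) < degree f"
      using u(1) assms(1) unfolding m[symmetric] by (intro degree_diff_less) auto
    \<comment> \<open>The case \<open>m = 0\<close> stands apart: if \<open>r\<close> and
      \<open>f\<close> have equal degree, no \<open>m\<close> has degree below the difference, but
      \<open>u = 1\<close> is still a root.\<close>
    then have "m = 0 \<or> degree m < degree f - degree r"
      using r by (cases "m = 0") (auto simp: degree_mult_eq)
    then have "m \<in> D"
      by (auto simp: D_def intro: coeff_eq_0)
    moreover have "u = 1 + r * m"
      using m by (simp add: algebra_simps eq_diff_eq)
    ultimately show "u \<in> (\<lambda>m. 1 + r * m) ` D"
      by blast
  next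
    fix u assume "u \<in> (\<lambda>m. 1 + r * m) ` D"
    then obtain m where m: "m \<in> D" "u = 1 + r * m"
      by blast
    have "degree (r * m) < degree f"
    proof (cases "m = 0")
      case False
      then have "degree m < degree f - degree r"
        using m(1) leading_coeff_neq_0[of m] by (force simp: D_def not_le[symmetric])
      then show ?thesis
        using False r by (simp add: degree_mult_eq)
    qed (use assms(1) in auto)
    then have "degree u < degree f"
      unfolding m(2) using assms(1) by (intro degree_add_less) auto
    moreover have "f dvd u ^ 2 - 1"
      by (simp add: square root m(2))
    ultimately show "u \<in> {u. degree u < degree f \<and> f dvd u ^ 2 - 1}"
      by blast
  qed
  have "[gauss_factorial f = \<Prod>((\<lambda>m. 1 + r * m) ` D)] (mod f)"
    using gauss_factorial_cong_prod_square_roots_of_1[OF assms(1)] by (simp add: roots)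
  also have "\<Prod>((\<lambda>m. 1 + r * m) ` D) = (\<Prod>m\<in>D. 1 + r * m)"
    using r by (subst prod.reindex) (auto intro!: inj_onI)
  \<comment> \<open>The congruence modulo \<open>r ^ 2\<close> descends to the divisor
    \<open>f\<close>.\<close>
  also have "[\<dots> = 1 + r * \<Sum>D] (mod f)"
    using cong_prod_one_plus_mult[of r "\<lambda>m. m" D] root[of r] cong_dvd_modulus by auto
  also have "1 + r * \<Sum>D = (if degree f = Suc (degree r) \<and> CARD('a) = 2 then 1 + r else 1)"
    using r by (auto simp: D_def sum_poly_coeff_bounded)
  finally show ?thesis .
qed

section \<open>Exponents of the factorization and the exceptional case\<close>

theorem theorem3p2:
  fixes f :: "'a::{finite,field} poly" and a :: 'a
    and P :: "nat \<Rightarrow> 'a poly" and e :: "nat \<Rightarrow> nat" and s t :: nat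
  assumes "s \<ge> 1" and "CARD('a) = 2 ^ s"
    and "degree f \<ge> 1"
    and "a \<noteq> 0"
    and "\<And>j. j \<in> {1..t} \<Longrightarrow> irreducible (P j)"
    and "\<And>j. j \<in> {1..t} \<Longrightarrow> lead_coeff (P j) = 1"
    and "inj_on P {1..t}"
    and "\<And>j. j \<in> {1..t} \<Longrightarrow> e j \<ge> 1"
    and "f = smult a (\<Prod>j\<in>{1..t}. P j ^ e j)"
  shows "(\<forall>k. exceptional_index t P e k \<longrightarrow> [gauss_factorial f = f div P k + 1] (mod f)) \<and>
         ((\<nexists>k. exceptional_index t P e k) \<longrightarrow> [gauss_factorial f = 1] (mod f))"
proof -
  define r where "r = (\<Prod>j\<in>{1..t}. P j ^ (e j - e j div 2))"
  \<comment> \<open>This is \<open>degree f - degree r\<close>, the number of free coefficients of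
    \<open>m\<close> in \<open>1 + r * m\<close>.\<close>
  define d where "d = (\<Sum>j\<in>{1..t}. (e j div 2) * degree (P j))"
  have P0: "P j \<noteq> 0" if "j \<in> {1..t}" for j
    using assms(6)[OF that] by auto
  have degP: "degree (P j) \<noteq> 0" if "j \<in> {1..t}" for j
    using assms(5)[OF that] P0[OF that] by (auto simp: irreducible_def is_unit_iff_degree)
  have two: "(2 :: 'a) = 0"
    using of_nat_CARD_eq_0[where 'a = 'a] assms(2) by simp
  have root: "f dvd h ^ 2 \<longleftrightarrow> r dvd h" for h
  proof
    assume "f dvd h ^ 2"
    then have "(\<Prod>j\<in>{1..t}. P j ^ e j) dvd h ^ 2"
      using assms(4,9) by (simp add: smult_dvd_iff)
    then show "r dvd h"
      unfolding r_def using assms(5-7)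
      by (intro prod_monic_irreducible_powers_dvd_square) auto
  next
    assume "r dvd h"
    \<comment> \<open>Twice \<open>e j / 2\<close> rounded up is at least
      \<open>e j\<close>.\<close>
    have "f dvd (\<Prod>j\<in>{1..t}. P j ^ ((e j - e j div 2) * 2))"
      unfolding assms(9) using assms(4)
      by (auto simp: smult_dvd_iff intro!: prod_dvd_prod le_imp_power_dvd)
    also have "\<dots> = r ^ 2"
      by (simp add: r_def prod_power_distrib power_mult)
    also have "r ^ 2 dvd h ^ 2"
      using \<open>r dvd h\<close> by (rule dvd_power_same)
    finally show "f dvd h ^ 2" .
  qed
  have "degree f = (\<Sum>j\<in>{1..t}. e j * degree (P j))"
    unfolding assms(9) using assms(4) P0 by (simp add: degree_prod_eq_sum_degree degree_power_eq)
  also have "\<dots> = (\<Sum>j\<in>{1..t}. (e j - e j div 2) * degree (P j) + (e j div 2) * degree (P j))"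
    by (intro sum.cong) (auto simp flip: distrib_right)
  also have "\<dots> = degree r + d"
    unfolding r_def d_def using P0
    by (simp add: sum.distrib degree_prod_eq_sum_degree degree_power_eq)
  finally have deg_f: "degree f = degree r + d" .
  have main: "[gauss_factorial f = (if d = 1 \<and> CARD('a) = 2 then 1 + r else 1)] (mod f)"
    using gauss_factorial_cong_char_2[OF assms(3) two root] by (simp add: deg_f)
  show ?thesis
  proof (intro conjI allI impI)
    fix k assume "exceptional_index t P e k"
    then have k: "k \<in> {1..t}" "CARD('a) = 2" "degree (P k) = 1" "2 \<le> e k" "e k \<le> 3"
      and others: "\<And>j. j \<in> {1..t} \<Longrightarrow> j \<noteq> k \<Longrightarrow> e j = 1"
      by (auto simp: exceptional_index_def)
    have ek: "e k div 2 = 1"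
      using k(4,5) by linarith
    \<comment> \<open>All other exponents are 1, and \<open>1 div 2 = 0\<close>.\<close>
    have "d = (\<Sum>j\<in>{k}. (e j div 2) * degree (P j))"
      unfolding d_def using k(1) others by (intro sum.mono_neutral_right) auto
    then have "d = 1"
      using ek k(3) by simp
    \<comment> \<open>Over two elements the unit \<open>a\<close> must be 1, so that
      \<open>f div P k\<close> is exactly \<open>r\<close>, not a multiple of it.\<close>
    have "{0, 1 :: 'a} = UNIV"
      by (rule card_subset_eq) (use k(2) in auto)
    then have "a = 1"
      using assms(4) by blast
    have "f = (\<Prod>j\<in>{1..t}. P j ^ e j)"
      by (simp add: assms(9) \<open>a = 1\<close>)
    also have "\<dots> = P k ^ e k * (\<Prod>j\<in>{1..t} - {k}. P j ^ e j)"
      using k(1) by (intro prod.remove) auto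
    \<comment> \<open>For exponents 2 and 3, rounding half up gives \<open>e k - 1\<close>.\<close>
    also have "P k ^ e k = P k * P k ^ (e k - e k div 2)"
      using ek k(4) by (simp flip: power_Suc)
    also have "(\<Prod>j\<in>{1..t} - {k}. P j ^ e j) = (\<Prod>j\<in>{1..t} - {k}. P j ^ (e j - e j div 2))"
      using others by (intro prod.cong) auto
    also have "P k * P k ^ (e k - e k div 2) * \<dots> = P k * r"
      unfolding r_def using k(1) by (subst prod.remove[of "{1..t}" k]) (simp_all add: mult.assoc)
    finally have "f div P k = r"
      using P0[OF k(1)] by simp
    then show "[gauss_factorial f = f div P k + 1] (mod f)"
      using main \<open>d = 1\<close> k(2) by (simp add: add.commute)
  next
    assume none: "\<nexists>k. exceptional_index t P e k"
    have "\<not> (d = 1 \<and> CARD('a) = 2)"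
    proof
      assume d: "d = 1 \<and> CARD('a) = 2"
      \<comment> \<open>A sum of natural numbers is 1 only if one summand is 1 and the rest are 0.
        As every \<open>P j\<close> has positive degree, the zero summands force
        \<open>e j div 2 = 0\<close>, hence \<open>e j = 1\<close>.\<close>
      then have "\<exists>k\<in>{1..t}. (e k div 2) * degree (P k) = 1 \<and>
          (\<forall>j\<in>{1..t}. k \<noteq> j \<longrightarrow> (e j div 2) * degree (P j) = 0)"
        by (simp only: d_def sum_eq_1_iff finite_atLeastAtMost)
      then obtain k where k: "k \<in> {1..t}" "(e k div 2) * degree (P k) = 1"
        and others: "\<And>j. j \<in> {1..t} \<Longrightarrow> k \<noteq> j \<Longrightarrow> (e j div 2) * degree (P j) = 0"
        by blast
      have "e j = 1" if "j \<in> {1..t}" "j \<noteq> k" for j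
        using others[OF that(1)] degP[OF that(1)] assms(8)[OF that(1)] that(2) by auto
      moreover have "e k div 2 = 1" "degree (P k) = 1"
        using k(2) by auto
      ultimately have "exceptional_index t P e k"
        using k(1) d by (auto simp: exceptional_index_def)
      with none show False
        by blast
    qed
    with main show "[gauss_factorial f = 1] (mod f)"
      by (simp split: if_splits)
  qed
qed

end
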